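(* For every integer $n\ge 0$ and every integer $k$ with $0\le k\le 2n$, we have $m_{n,k-n}=s_{n,k}$.
   Context: A Motzkin path is a lattice path starting at $(0,0)$ whose steps are $(1,0)$, $(1,1)$ or $(1,-1)$. It is not required to stay above the $x$-axis. It is peakless if no step $(1,1)$ is immediately followed by a step $(1,-1)$. $m_{a,b}$ denotes the number of peakless Motzkin paths from $(0,0)$ to $(a,b)$. A 0-1-2 sum with $n$ summands is a sequence $(e_1,\dots,e_n)$ with each $e_i\in\{0,1,2\}$ such that whenever $e_i=2$ and $i<n$ we have $e_{i+1}\ne0$. Its value is $\sum e_i$. $s_{n,k}$ is the number of 0-1-2 sums with $n$ summands and value $k$. *)

theory Defs
  imports Main "HOL-Library.Product_Plus"
begin

text \<open>A lattice path starting at the origin is represented by its list of steps; since it starts at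
  \<open>(0, 0)\<close>, its endpoint is the componentwise sum of the steps. No nonnegativity of the
  height is imposed.\<close>

definition motzkin_path :: "(int \<times> int) list \<Rightarrow> bool" where
  "motzkin_path p \<longleftrightarrow> set p \<subseteq> {(1, 0), (1, 1), (1, -1)}"

definition path_end :: "(int \<times> int) list \<Rightarrow> int \<times> int" where
  "path_end p = sum_list p"

definition peakless :: "(int \<times> int) list \<Rightarrow> bool" where
  "peakless p \<longleftrightarrow> \<not> (\<exists>i. Suc i < length p \<and> p ! i = (1, 1) \<and> p ! Suc i = (1, -1))"

definition peakless_motzkin_paths :: "int \<Rightarrow> int \<Rightarrow> (int \<times> int) list set" where
  "peakless_motzkin_paths a b = {p. motzkin_path p \<and> peakless p \<and> path_end p = (a, b)}"

definition num_peakless_motzkin :: "int \<Rightarrow> int \<Rightarrow> nat" where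
  "num_peakless_motzkin a b = card (peakless_motzkin_paths a b)"

definition sum012 :: "nat list \<Rightarrow> bool" where
  "sum012 e \<longleftrightarrow> set e \<subseteq> {0, 1, 2} \<and> (\<forall>i. Suc i < length e \<and> e ! i = 2 \<longrightarrow> e ! Suc i \<noteq> 0)"

definition sums012 :: "nat \<Rightarrow> nat \<Rightarrow> nat list set" where
  "sums012 n k = {e. sum012 e \<and> length e = n \<and> sum_list e = k}"

definition num_sums012 :: "nat \<Rightarrow> nat \<Rightarrow> nat" where
  "num_sums012 n k = card (sums012 n k)"

text \<open>Both families are finite, so the cardinalities above are genuine counts.\<close>

lemma path_end_fst:
  assumes "motzkin_path p"
  shows "fst (path_end p) = int (length p)"
  using assms by (induction p) (auto simp: motzkin_path_def path_end_def)

lemma finite_peakless_motzkin_paths: "finite (peakless_motzkin_paths a b)"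
proof (rule finite_subset)
  show "peakless_motzkin_paths a b
    \<subseteq> {p. set p \<subseteq> {(1, 0), (1, 1), (1, -1)} \<and> length p = nat a}"
    using path_end_fst by (fastforce simp: peakless_motzkin_paths_def motzkin_path_def)
qed (rule finite_lists_length_eq, simp)

lemma finite_sums012: "finite (sums012 n k)"
proof (rule finite_subset)
  show "sums012 n k \<subseteq> {e. set e \<subseteq> {0, 1, 2} \<and> length e = n}"
    by (auto simp: sums012_def sum012_def)
qed (rule finite_lists_length_eq, simp)

end

theory Submission
  imports Defs
begin

text \<open>Subtracting 1 from every summand turns 0, 1, 2 into the height changes -1, 0, 1 of the
  Motzkin steps. The total of n summands then drops by n, so value k becomes final height k - n, and
  the forbidden pattern 2, 0 becomes a peak. Hence \<open>map step_of\<close> is a bijection between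
  the two families: \<open>map_step_of_mem_paths_iff\<close> matches the conditions, and
  \<open>map_step_of_digit_of\<close> gives surjectivity.\<close>

definition step_of :: "nat \<Rightarrow> int \<times> int" where
  "step_of d = (1, int d - 1)"

definition digit_of :: "int \<times> int \<Rightarrow> nat" where
  "digit_of s = nat (snd s + 1)"

lemma digit_of_step_of [simp]: "digit_of (step_of d) = d"
  by (simp add: step_of_def digit_of_def)

lemma path_end_map_step_of:
  "path_end (map step_of e) = (int (length e), int (sum_list e) - int (length e))"
  by (induction e) (auto simp: path_end_def step_of_def zero_prod_def)

lemma motzkin_path_map_step_of:
  "motzkin_path (map step_of e) \<longleftrightarrow> set e \<subseteq> {0, 1, 2}"
  by (induction e) (auto simp: motzkin_path_def step_of_def)

text \<open>Only the digit 2 gives the up step and only 0 gives the down step, so peaks occur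
  exactly where a 2 is followed by a 0.\<close>

lemma peakless_map_step_of:
  "peakless (map step_of e) \<longleftrightarrow> (\<forall>i. Suc i < length e \<and> e ! i = 2 \<longrightarrow> e ! Suc i \<noteq> 0)"
proof -
  have "step_of d = (1, 1) \<longleftrightarrow> d = 2" "step_of d = (1, -1) \<longleftrightarrow> d = 0" for d
    by (auto simp: step_of_def)
  then show ?thesis
    by (auto simp: peakless_def)
qed

text \<open>Stated for arbitrary \<open>e\<close>, so that one equivalence serves both inclusions of
  the bijection.\<close>

lemma map_step_of_mem_paths_iff:
  "map step_of e \<in> peakless_motzkin_paths (int n) (int k - int n) \<longleftrightarrow> e \<in> sums012 n k"
  by (auto simp: peakless_motzkin_paths_def sums012_def sum012_def path_end_map_step_of
      motzkin_path_map_step_of peakless_map_step_of)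

text \<open>A Motzkin step has first coordinate 1 and height change at least -1, so
  \<open>nat\<close> in \<open>digit_of\<close> truncates nothing and no information is
  lost.\<close>

lemma map_step_of_digit_of:
  assumes "motzkin_path p"
  shows "map step_of (map digit_of p) = p"
  using assms by (induction p) (auto simp: motzkin_path_def step_of_def digit_of_def)

theorem theorem5:
  fixes n k :: nat
  assumes "k \<le> 2 * n"
  shows "num_peakless_motzkin (int n) (int k - int n) = num_sums012 n k"
proof -
  let ?P = "peakless_motzkin_paths (int n) (int k - int n)"
  have inverse: "map step_of (map digit_of p) = p" if "p \<in> ?P" for p
    using that by (intro map_step_of_digit_of) (simp add: peakless_motzkin_paths_def)
  have "bij_betw (map step_of) (sums012 n k) ?P"
  proof (rule bij_betw_byWitness[where f' = "map digit_of"])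
    show "\<forall>e\<in>sums012 n k. map digit_of (map step_of e) = e"
      by (simp add: comp_def)
    show "\<forall>p\<in>?P. map step_of (map digit_of p) = p"
      using inverse by blast
    show "map step_of ` sums012 n k \<subseteq> ?P"
      using map_step_of_mem_paths_iff by blast
    \<comment> \<open>Rewrite \<open>p\<close> as \<open>map step_of (map digit_of p)\<close> and
      read the equivalence from left to right with \<open>e\<close> the digit list of
      \<open>p\<close>.\<close>
    show "map digit_of ` ?P \<subseteq> sums012 n k"
      using inverse map_step_of_mem_paths_iff by (metis image_subsetI)
  qed
  then show ?thesis
    unfolding num_peakless_motzkin_def num_sums012_def
    by (rule bij_betw_same_card[symmetric])
qed

end
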